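(* Let $\mathcal{X}\subseteq\mathbb{R}^d$ be closed and convex, let $f$ be $\mu$-strongly convex on $\mathcal{X}$ ($\mu>0$; $f$ not necessarily smooth) with unique minimizer $x^*$ over $\mathcal{X}$, and suppose the stochastic gradient oracle is unbiased and bounded by $G^2$. Run projected SGD with step decay step-size with $T>1$ iterations, decay factor $\alpha>1$, inner-loop size $S=T/\log_\alpha T$, outer-loop size $N=T/S=\log_\alpha T$, $x_1^1\in\mathcal{X}$, and initial step-size $0<\eta_0<1/(2\mu)$. Then $$\mathbb{E}[f(x_S^N)-f(x^* )]\le\frac{R\ln T}{A_4\exp\left(B_4\frac{T-\alpha}{\ln T}\right)}+C_4\frac{\ln T+2}{T}+D_4\exp\left(\frac{E_4}{\ln T}\right)\frac{\ln^2T}{T},$$ where $R=\|x_1^1-x^*\|^2$, $A_4=\eta_0\alpha\ln\alpha$, $B_4=2\mu A_4/(\alpha-1)$, $C_4=G^2\eta_0\alpha$, $D_4=G^2/(2\mu\ln\alpha\cdot B_4)$, and $E_4=\alpha B_4$.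
   Context: $\|\cdot\|$ is the Euclidean norm, $\partial f(x)$ the subdifferential. $f$ is $\mu$-strongly convex on $\mathcal{X}$ if $f(y)\ge f(x)+\langle g,y-x\rangle+\frac\mu2\|y-x\|^2$ for all $x,y\in\mathcal{X}$, $g\in\partial f(x)$. Stochastic gradient oracle: queried at $x\in\mathcal{X}$ it returns a random vector $\hat g$ which (conditionally on the past of the algorithm) satisfies $\mathbb{E}[\hat g]=g$ for some $g\in\partial f(x)$. It is bounded by $G^2$ ($G>0$ fixed) if for every input, $\mathbb{E}[\|\hat g\|^2]\le G^2$. Projected SGD with step decay step-size. Inputs: $x_1^1$, $\eta_0$, $\alpha>1$, $T$, $S$, $N=T/S$. For $t=1,\dots,N$: set $\eta_t=\eta_0/\alpha^{t-1}$; for $i=1,\dots,S$: query the oracle at $x_i^t$ to obtain $\hat g_i^t$ and set $x_{i+1}^t=\Pi_{\mathcal{X}}(x_i^t-\eta_t\hat g_i^t)$, where $\Pi_{\mathcal{X}}$ is the Euclidean projection onto $\mathcal{X}$; then set $x_1^{t+1}=x_{S+1}^t$. Standing convention: $S$ and $N$ are assumed to be (positive) integers. *)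

theory Defs
  imports "HOL-Probability.Probability"
begin

text \<open>
  The objective is a real-valued function on a set \<open>D\<close> (its effective domain) that contains the
  feasible set \<open>X\<close>; \<open>D = UNIV\<close> is the everywhere finite case. Values of \<open>f\<close> outside \<open>D\<close> play no role.
\<close>

definition subdifferential :: "'a::real_inner set \<Rightarrow> ('a \<Rightarrow> real) \<Rightarrow> 'a \<Rightarrow> 'a set" where
  "subdifferential D f x = {g. \<forall>y\<in>D. f y \<ge> f x + g \<bullet> (y - x)}"

definition strongly_convex_on ::
  "'a::real_inner set \<Rightarrow> 'a set \<Rightarrow> ('a \<Rightarrow> real) \<Rightarrow> real \<Rightarrow> bool" where
  "strongly_convex_on D X f \<mu> \<longleftrightarrow>
     (\<forall>x\<in>X. \<forall>y\<in>X. \<forall>g\<in>subdifferential D f x.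
        f y \<ge> f x + g \<bullet> (y - x) + \<mu> / 2 * (norm (y - x))\<^sup>2)"

text \<open>The library has only real-valued conditional expectations, so vectors are treated coordinatewise.\<close>

definition vec_cond_exp ::
  "'w measure \<Rightarrow> 'w measure \<Rightarrow> ('w \<Rightarrow> 'a::euclidean_space) \<Rightarrow> 'w \<Rightarrow> 'a" where
  "vec_cond_exp M F h = (\<lambda>\<omega>. \<Sum>b\<in>Basis. real_cond_exp M F (\<lambda>w. h w \<bullet> b) \<omega> *\<^sub>R b)"

text \<open>
  An oracle is a family \<open>orc\<close>, where \<open>orc k x \<omega>\<close> is the answer to query number \<open>k\<close> (counted from
  0) if that query is made at the point \<open>x\<close>. The sigma-algebra \<open>F k\<close> is the past of query number \<open>k\<close>.
  Since the algorithm queries random points, the oracle must accept every \<open>X\<close>-valued point \<open>q\<close>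
  that is determined by the past; constant \<open>q\<close> gives the deterministic inputs \<open>x \<in> X\<close>.
\<close>

definition queries :: "'w measure \<Rightarrow> 'w measure \<Rightarrow> 'a::euclidean_space set \<Rightarrow> ('w \<Rightarrow> 'a) set" where
  "queries M Fk X = {q \<in> borel_measurable Fk. \<forall>\<omega>\<in>space M. q \<omega> \<in> X}"

definition unbiased_oracle ::
  "'w measure \<Rightarrow> (nat \<Rightarrow> 'w measure) \<Rightarrow> 'a::euclidean_space set \<Rightarrow> 'a set \<Rightarrow> ('a \<Rightarrow> real) \<Rightarrow>
   (nat \<Rightarrow> 'a \<Rightarrow> 'w \<Rightarrow> 'a) \<Rightarrow> bool" where
  "unbiased_oracle M F D X f orc \<longleftrightarrow>
     (\<forall>k. \<forall>q\<in>queries M (F k) X.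
        integrable M (\<lambda>\<omega>. orc k (q \<omega>) \<omega>) \<and>
        (AE \<omega> in M. vec_cond_exp M (F k) (\<lambda>w. orc k (q w) w) \<omega> \<in> subdifferential D f (q \<omega>)))"

definition bounded_oracle ::
  "'w measure \<Rightarrow> (nat \<Rightarrow> 'w measure) \<Rightarrow> 'a::euclidean_space set \<Rightarrow>
   (nat \<Rightarrow> 'a \<Rightarrow> 'w \<Rightarrow> 'a) \<Rightarrow> real \<Rightarrow> bool" where
  "bounded_oracle M F X orc B \<longleftrightarrow>
     (\<forall>k. \<forall>q\<in>queries M (F k) X.
        integrable M (\<lambda>\<omega>. (norm (orc k (q \<omega>) \<omega>))\<^sup>2) \<and>
        (LINT \<omega>|M. (norm (orc k (q \<omega>) \<omega>))\<^sup>2) \<le> B)"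

text \<open>
  Below, \<open>ans\<close> gives the oracle's answers for one fixed outcome: \<open>ans j x\<close> answers query number \<open>j\<close>.
  \<open>inner_loop\<close> is one stage of projected SGD with constant step-size; after \<open>i\<close> steps it has reached
  the stage's iterate number \<open>i + 1\<close>.
\<close>

primrec inner_loop ::
  "'a::euclidean_space set \<Rightarrow> real \<Rightarrow> (nat \<Rightarrow> 'a \<Rightarrow> 'a) \<Rightarrow> 'a \<Rightarrow> nat \<Rightarrow> 'a" where
  "inner_loop X \<eta> ans y 0 = y"
| "inner_loop X \<eta> ans y (Suc i) =
     (let x = inner_loop X \<eta> ans y i in closest_point X (x - \<eta> *\<^sub>R ans i x))"

text \<open>\<open>stage_start X \<eta>0 \<alpha> S ans x1 t\<close> is the initial point of stage \<open>t + 1\<close>.\<close>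

primrec stage_start ::
  "'a::euclidean_space set \<Rightarrow> real \<Rightarrow> real \<Rightarrow> nat \<Rightarrow> (nat \<Rightarrow> 'a \<Rightarrow> 'a) \<Rightarrow> 'a \<Rightarrow> nat \<Rightarrow> 'a" where
  "stage_start X \<eta>0 \<alpha> S ans x1 0 = x1"
| "stage_start X \<eta>0 \<alpha> S ans x1 (Suc t) =
     inner_loop X (\<eta>0 / \<alpha> ^ t) (\<lambda>j. ans (t * S + j)) (stage_start X \<eta>0 \<alpha> S ans x1 t) S"

text \<open>
  The iterate \<open>x\<^sub>i\<close> of stage \<open>t\<close>, for \<open>t, i \<ge> 1\<close>. It is the point of query number
  \<open>(t - 1) * S + (i - 1)\<close> when \<open>i \<le> S\<close>.
\<close>

definition step_decay_sgd ::
  "'a::euclidean_space set \<Rightarrow> real \<Rightarrow> real \<Rightarrow> nat \<Rightarrow> (nat \<Rightarrow> 'a \<Rightarrow> 'w \<Rightarrow> 'a) \<Rightarrow> 'a \<Rightarrow>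
   nat \<Rightarrow> nat \<Rightarrow> 'w \<Rightarrow> 'a" where
  "step_decay_sgd X \<eta>0 \<alpha> S orc x1 t i = (\<lambda>\<omega>.
     inner_loop X (\<eta>0 / \<alpha> ^ (t - 1)) (\<lambda>j x. orc ((t - 1) * S + j) x \<omega>)
       (stage_start X \<eta>0 \<alpha> S (\<lambda>j x. orc j x \<omega>) x1 (t - 1)) (i - 1))"

end

theory Submission
  imports Defs
begin

text \<open>
  Flattening the two loops gives iterates \<open>Z k\<close> with step-size \<open>\<eta> k = \<eta>0 / \<alpha> ^ (k div S)\<close>. Conditioning on
  the past and nonexpansiveness of the projection give, for every feasible \<open>u\<close> known before query \<open>k\<close>,
  \<open>E |Z (k + 1) - u|^2 \<le> E |Z k - u|^2 - 2 (\<eta> k) E (f (Z k) - f u) + (\<eta> k)^2 G^2\<close>. With reference point \<open>xs\<close> and quadratic growth,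
  \<open>E |Z k - xs|^2\<close> contracts by \<open>1 - 2 \<mu> \<eta> k\<close> up to noise \<open>(\<eta> k)^2 G^2\<close>; iterating over all stages but
  the last bounds the error at the start of the last stage. There the step-size is constant and
  equal to \<open>\<eta>0 \<alpha> / T\<close>, and taking earlier iterates as reference points (the argument of Shamir and
  Zhang) turns the bound for the average of the stage into one for its last iterate, at the price of
  a harmonic sum, which is the logarithm in the second term.
\<close>

section \<open>Recursive inequalities and harmonic sums\<close>

lemma affine_recursion_le:
  fixes a :: "nat \<Rightarrow> real"
  assumes "r \<ge> 0" and step: "\<And>i. i < n \<Longrightarrow> a (Suc i) - p \<le> r * (a i - p)"
  shows "a n - p \<le> r ^ n * (a 0 - p)"
  using step
proof (induction n)
  case (Suc n)
  have "a (Suc n) - p \<le> r * (a n - p)"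
    using Suc.prems by simp
  also have "\<dots> \<le> r * (r ^ n * (a 0 - p))"
    using Suc \<open>r \<ge> 0\<close> by (intro mult_left_mono) auto
  finally show ?case
    by (simp add: mult.assoc)
qed simp

text \<open>
  With \<open>v t = c / \<alpha> ^ t\<close>, stage \<open>t\<close> multiplies the initial error by at most
  \<open>exp (v (t + 1) - v t)\<close> and moves the noise towards its stationary level \<open>K * v (t + 1)\<close>;
  the invariant for the noise is \<open>K * (1 + v t)\<close>, by \<open>1 + x \<le> exp x\<close>.
\<close>

lemma step_decay_recursion_le:
  fixes a :: "nat \<Rightarrow> real" and c K \<alpha> :: real and \<rho> :: "nat \<Rightarrow> real"
  assumes "\<alpha> > 1" "c \<ge> 0" "K \<ge> 0" "a 0 \<ge> 0"
    and \<rho>: "\<And>t. t < n \<Longrightarrow> 0 \<le> \<rho> t" "\<And>t. t < n \<Longrightarrow> \<rho> t \<le> exp (c / \<alpha> ^ Suc t - c / \<alpha> ^ t)"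
    and step: "\<And>t. t < n \<Longrightarrow>
      a (Suc t) - K * (c / \<alpha> ^ Suc t) \<le> \<rho> t * (a t - K * (c / \<alpha> ^ Suc t))"
  shows "a n \<le> exp (c / \<alpha> ^ n - c) * a 0 + K * (1 + c / \<alpha> ^ n)"
  using \<rho> step
proof (induction n)
  case 0
  then show ?case using assms by simp
next
  case (Suc n)
  define v w where "v = c / \<alpha> ^ n" and "w = c / \<alpha> ^ Suc n"
  have "w \<le> v" unfolding v_def w_def
    using assms by (intro divide_left_mono) (auto simp: mult_le_cancel_right1)
  have r: "0 \<le> \<rho> n" "\<rho> n \<le> exp (w - v)"
    using Suc.prems(1,2)[of n] by (simp_all add: v_def w_def)
  have "a n \<le> exp (v - c) * a 0 + K * (1 + v)"
    unfolding v_def by (rule Suc.IH) (use Suc.prems in auto)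
  then have "\<rho> n * (a n - K * w) \<le> \<rho> n * (exp (v - c) * a 0 + K * (1 + (v - w)))"
    using r by (intro mult_left_mono) (auto simp: algebra_simps)
  \<comment> \<open>Raising the factor \<open>\<rho> n\<close> needs a nonnegative bracket, which
    \<open>w \<le> v\<close> provides; \<open>a n - K * w\<close> may be negative, so it was bounded
    first.\<close>
  also have "\<dots> \<le> exp (w - v) * (exp (v - c) * a 0 + K * (1 + (v - w)))"
    using r assms \<open>w \<le> v\<close> by (intro mult_right_mono add_nonneg_nonneg mult_nonneg_nonneg) auto
  also have "\<dots> \<le> exp (w - v) * (exp (v - c) * a 0 + K * exp (v - w))"
    using assms by (intro mult_left_mono add_left_mono) (auto simp: exp_ge_add_one_self)
  also have "\<dots> = exp (w - c) * a 0 + K"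
    by (simp add: distrib_left flip: exp_add mult.assoc)
  finally have "\<rho> n * (a n - K * w) \<le> exp (w - c) * a 0 + K" .
  moreover have "a (Suc n) - K * w \<le> \<rho> n * (a n - K * w)"
    using Suc.prems(3)[of n] by (simp add: w_def)
  ultimately show ?case
    unfolding w_def[symmetric] by (simp add: distrib_left)
qed

text \<open>
  The Shamir--Zhang argument: the hypothesis compares each tail average with its first term, so the
  averages over the last \<open>k\<close> terms grow by at most \<open>c / k\<close> when \<open>k + 1\<close> is lowered to \<open>k\<close>.
\<close>

lemma last_le_average_plus_harm:
  fixes \<phi> :: "nat \<Rightarrow> real"
  assumes "n \<ge> 1"
    and tail: "\<And>j. j < n \<Longrightarrow> (\<Sum>i\<in>{j..<n}. \<phi> i) \<le> real (n - j) * (\<phi> j + c)"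
  shows "\<phi> (n - 1) \<le> (\<Sum>i<n. \<phi> i) / real n + c * harm (n - 1)"
proof -
  \<comment> \<open>Induction over windows of the last \<open>k + 1\<close> terms, from the single
    last term up to the full average at \<open>k = n - 1\<close>.\<close>
  have "\<phi> (n - 1) \<le> (\<Sum>i\<in>{n - Suc k..<n}. \<phi> i) / real (Suc k) + c * harm k" if "k < n" for k
    using that
  proof (induction k)
    case 0
    have "{n - 1..<n} = {n - 1}" using 0 by auto
    then show ?case by (simp add: harm_def)
  next
    case (Suc k)
    define s s' where "s = (\<Sum>i\<in>{n - Suc k..<n}. \<phi> i)" and "s' = (\<Sum>i\<in>{n - Suc (Suc k)..<n}. \<phi> i)"
    have "{n - Suc (Suc k)..<n} = insert (n - Suc (Suc k)) {n - Suc k..<n}"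
      using Suc.prems by auto
    then have s': "s' = \<phi> (n - Suc (Suc k)) + s"
      using Suc.prems by (simp add: s_def s'_def)
    have "s' \<le> real (Suc (Suc k)) * (\<phi> (n - Suc (Suc k)) + c)"
      using tail[of "n - Suc (Suc k)"] Suc.prems by (simp add: s'_def)
    \<comment> \<open>The added term is \<open>s' - s\<close>. With \<open>m\<close> the new
      average, \<open>s' = (k + 2) * m\<close>, so the old sum \<open>s\<close> is at most
      \<open>(k + 1) * m + c\<close>.\<close>
    then have le: "s' / real (Suc (Suc k)) \<le> s' - s + c"
      unfolding s' by (simp add: divide_le_eq mult.commute)
    define m where "m = s' / real (Suc (Suc k))"
    have "s' = real (Suc (Suc k)) * m"
      by (simp add: m_def)
    then have "s \<le> real (Suc k) * m + c"
      using le unfolding m_def[symmetric] by (simp add: algebra_simps)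
    then have "s / real (Suc k) \<le> s' / real (Suc (Suc k)) + c / real (Suc k)"
      unfolding m_def[symmetric]
      by (subst pos_divide_le_eq) (simp_all del: of_nat_Suc add: distrib_left mult.commute)
    moreover have "\<phi> (n - 1) \<le> s / real (Suc k) + c * harm k"
      unfolding s_def using Suc by simp
    ultimately show ?case
      unfolding s'_def[symmetric] by (simp add: harm_Suc distrib_left divide_inverse)
  qed
  from this[of "n - 1"] show ?thesis
    using assms(1) by (simp add: lessThan_atLeast0)
qed

text \<open>\<open>harm n - ln n\<close> decreases in \<open>n\<close> and equals 1 at
  \<open>n = 1\<close>.\<close>

lemma harm_le_one_plus_ln:
  assumes "n \<ge> 1"
  shows "harm n \<le> 1 + ln (real n)"
  using decseq_harm_diff_ln[THEN decseqD, of 0 "n - 1"] assms by (simp add: harm_def)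

section \<open>Quadratic growth and measurability of the objective\<close>

text \<open>Subgradients are taken relative to \<open>D\<close>, over which \<open>xs\<close> need
  not be minimal, so 0 need not be a subgradient at \<open>xs\<close>. Instead strong convexity is
  applied at a point \<open>z\<close> of the segment from \<open>xs\<close> to \<open>x\<close>, and
  \<open>z\<close> then tends to \<open>xs\<close>.\<close>

lemma strongly_convex_on_quadratic_growth:
  assumes "convex X" and "strongly_convex_on D X f \<mu>"
    and sub: "\<And>x. x \<in> X \<Longrightarrow> subdifferential D f x \<noteq> {}"
    and "xs \<in> X" and min: "\<And>x. x \<in> X \<Longrightarrow> f xs \<le> f x" and "x \<in> X"
  shows "\<mu> / 2 * (norm (x - xs))\<^sup>2 \<le> f x - f xs"
proof -
  define A where "A = \<mu> / 2 * (norm (x - xs))\<^sup>2"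
  have *: "(1 - t) * A \<le> f x - f xs" if t: "t \<in> {0<..<1}" for t
  proof -
    define z where "z = xs + t *\<^sub>R (x - xs)"
    have "z = (1 - t) *\<^sub>R xs + t *\<^sub>R x"
      by (simp add: z_def algebra_simps)
    then have "z \<in> X"
      using t assms by (auto intro!: convexD)
    then obtain g where g: "g \<in> subdifferential D f z"
      using sub by blast
    have n: "xs - z = (- t) *\<^sub>R (x - xs)" "x - z = (1 - t) *\<^sub>R (x - xs)"
      by (simp_all add: z_def algebra_simps)
    have 1: "f xs \<ge> f z + g \<bullet> (xs - z) + \<mu> / 2 * (norm (xs - z))\<^sup>2"
      and 2: "f x \<ge> f z + g \<bullet> (x - z) + \<mu> / 2 * (norm (x - z))\<^sup>2"
      using assms(2) g \<open>z \<in> X\<close> \<open>x \<in> X\<close> \<open>xs \<in> X\<close> by (auto simp: strongly_convex_on_def)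
    have 1: "f xs \<ge> f z - t * (g \<bullet> (x - xs)) + t\<^sup>2 * A"
      using 1 unfolding n norm_scaleR by (simp add: A_def power_mult_distrib mult.left_commute)
    have 2: "f x \<ge> f z + (1 - t) * (g \<bullet> (x - xs)) + (1 - t)\<^sup>2 * A"
      using 2 unfolding n norm_scaleR by (simp add: A_def power_mult_distrib mult.left_commute)
    \<comment> \<open>With weights \<open>1 - t\<close> and \<open>t\<close> the linear terms cancel
      and the quadratic ones add up to \<open>t * (1 - t) * A\<close>.\<close>
    have "(1 - t) * f xs + t * f x \<ge> f z + t * ((1 - t) * A)"
      using add_mono[OF mult_left_mono[OF 1, of "1 - t"] mult_left_mono[OF 2, of t]] t
      by (simp add: algebra_simps power2_eq_square)
    then have "t * ((1 - t) * A) \<le> t * (f x - f xs)"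
      using min[OF \<open>z \<in> X\<close>] by (simp add: algebra_simps)
    then show ?thesis
      using t by simp
  qed
  have "((\<lambda>t. (1 - t) * A) \<longlongrightarrow> (1 - 0) * A) (at_right 0)"
    by (intro tendsto_intros)
  then have "(1 - 0) * A \<le> f x - f xs"
    by (rule tendsto_upperbound)
       (use * in \<open>auto simp: eventually_at_right_field intro!: exI[of _ 1]\<close>)
  then show ?thesis by (simp add: A_def)
qed

text \<open>On \<open>X\<close>, \<open>f\<close> is the supremum of its supporting affine functions, hence lower semicontinuous.\<close>

lemma borel_measurable_of_subgradients:
  fixes X :: "'a::euclidean_space set"
  assumes "X \<in> sets borel" and "X \<subseteq> D"
    and sub: "\<And>x. x \<in> X \<Longrightarrow> subdifferential D f x \<noteq> {}"
  shows "(\<lambda>x. if x \<in> X then f x else 0) \<in> borel_measurable borel"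
proof -
  obtain g where g: "\<And>x. x \<in> X \<Longrightarrow> g x \<in> subdifferential D f x"
    using bchoice[of X "\<lambda>x g. g \<in> subdifferential D f x"] sub by blast
  have "{y. a < (if y \<in> X then f y else 0)} \<in> sets borel" for a
  proof -
    \<comment> \<open>The union may be uncountable, so its measurability comes from
      openness.\<close>
    define U where "U = (\<Union>x\<in>X. {y. a < f x + g x \<bullet> (y - x)})"
    have "open U" unfolding U_def
      by (intro open_UN ballI open_Collect_less continuous_intros)
    have "a < f y \<longleftrightarrow> y \<in> U" if "y \<in> X" for y
    proof
      assume "a < f y"
      with that show "y \<in> U"
        unfolding U_def by (intro UN_I[of y]) auto
    next
      assume "y \<in> U"
      then obtain x where "x \<in> X" "a < f x + g x \<bullet> (y - x)"
        by (auto simp: U_def)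
      moreover have "f x + g x \<bullet> (y - x) \<le> f y"
        using g[OF \<open>x \<in> X\<close>] that \<open>X \<subseteq> D\<close> by (auto simp: subdifferential_def)
      ultimately show "a < f y" by linarith
    qed
    then have "{y. a < (if y \<in> X then f y else 0)} = (X \<inter> U) \<union> ((- X) \<inter> {y. a < 0})"
      by auto
    then show ?thesis
      using \<open>X \<in> sets borel\<close> \<open>open U\<close> by (cases "a < 0") auto
  qed
  then show ?thesis
    by (simp add: borel_measurable_iff_greater)
qed

section \<open>Conditional expectation, square integrability and projection\<close>

text \<open>Coordinatewise pull-out: each coordinate of \<open>w\<close> is known given
  \<open>F\<close>, so multiplying by it commutes with conditioning. Square integrability makes the
  products integrable.\<close>

lemma (in sigma_finite_subalgebra) vec_cond_exp_inner:
  fixes h w :: "'a \<Rightarrow> 'b::euclidean_space"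
  assumes [measurable]: "w \<in> borel_measurable F" "h \<in> borel_measurable M"
    and "integrable M (\<lambda>\<omega>. (norm (h \<omega>))\<^sup>2)" and "integrable M (\<lambda>\<omega>. (norm (w \<omega>))\<^sup>2)"
  shows "integrable M (\<lambda>\<omega>. vec_cond_exp M F h \<omega> \<bullet> w \<omega>)"
    and "integrable M (\<lambda>\<omega>. h \<omega> \<bullet> w \<omega>)"
    and "(LINT \<omega>|M. vec_cond_exp M F h \<omega> \<bullet> w \<omega>) = (LINT \<omega>|M. h \<omega> \<bullet> w \<omega>)"
proof -
  have [measurable]: "w \<in> borel_measurable M"
    by (rule measurable_from_subalg[OF subalg assms(1)])
  have int: "integrable M (\<lambda>\<omega>. (norm (h \<omega>))\<^sup>2 + (norm (w \<omega>))\<^sup>2)"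
    using assms by simp
  have prod: "\<bar>s * t\<bar> \<le> p\<^sup>2 + q\<^sup>2" if "\<bar>s\<bar> \<le> p" "\<bar>t\<bar> \<le> q" for s t p q :: real
  proof -
    have "\<bar>s * t\<bar> \<le> p * q"
      unfolding abs_mult using that by (intro mult_mono) auto
    also have "\<dots> \<le> p\<^sup>2 + q\<^sup>2"
      using sum_squares_bound[of p q] zero_le_power2[of p] zero_le_power2[of q] by linarith
    finally show ?thesis .
  qed
  have b: "integrable M (\<lambda>\<omega>. (w \<omega> \<bullet> b) * (h \<omega> \<bullet> b))" if "b \<in> Basis" for b
  proof (rule Bochner_Integration.integrable_bound[OF int])
    show "AE \<omega> in M. norm ((w \<omega> \<bullet> b) * (h \<omega> \<bullet> b)) \<le> norm ((norm (h \<omega>))\<^sup>2 + (norm (w \<omega>))\<^sup>2)"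
      using prod[OF Basis_le_norm[OF that] Basis_le_norm[OF that]] by (subst add.commute, simp)
  qed measurable
  note c = real_cond_exp_intg[OF b]
  have eq: "vec_cond_exp M F h \<omega> \<bullet> w \<omega> =
      (\<Sum>b\<in>Basis. (w \<omega> \<bullet> b) * real_cond_exp M F (\<lambda>w. h w \<bullet> b) \<omega>)" for \<omega>
    by (subst inner_commute) (simp add: vec_cond_exp_def inner_sum_right mult.commute)
  have eq': "h \<omega> \<bullet> w \<omega> = (\<Sum>b\<in>Basis. (w \<omega> \<bullet> b) * (h \<omega> \<bullet> b))" for \<omega>
    by (subst euclidean_inner) (simp add: mult.commute)
  show "integrable M (\<lambda>\<omega>. vec_cond_exp M F h \<omega> \<bullet> w \<omega>)"
    unfolding eq by (intro Bochner_Integration.integrable_sum c) auto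
  show "integrable M (\<lambda>\<omega>. h \<omega> \<bullet> w \<omega>)"
    unfolding eq' by (intro Bochner_Integration.integrable_sum b)
  show "(LINT \<omega>|M. vec_cond_exp M F h \<omega> \<bullet> w \<omega>) = (LINT \<omega>|M. h \<omega> \<bullet> w \<omega>)"
    unfolding eq eq' by (subst (1 2) Bochner_Integration.integral_sum) (auto intro!: c b sum.cong)
qed

lemma integrable_norm_diff_squared:
  fixes u v :: "'w \<Rightarrow> 'a::euclidean_space"
  assumes [measurable]: "u \<in> borel_measurable M" "v \<in> borel_measurable M"
    and u: "integrable M (\<lambda>\<omega>. (norm (u \<omega> - c))\<^sup>2)" and v: "integrable M (\<lambda>\<omega>. (norm (v \<omega> - c))\<^sup>2)"
  shows "integrable M (\<lambda>\<omega>. (norm (u \<omega> - v \<omega>))\<^sup>2)"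
proof (rule Bochner_Integration.integrable_bound)
  show "integrable M (\<lambda>\<omega>. 2 * (norm (u \<omega> - c))\<^sup>2 + 2 * (norm (v \<omega> - c))\<^sup>2)"
    using u v by simp
  have "(norm (u \<omega> - v \<omega>))\<^sup>2 \<le> 2 * (norm (u \<omega> - c))\<^sup>2 + 2 * (norm (v \<omega> - c))\<^sup>2" for \<omega>
  proof -
    have "norm (u \<omega> - v \<omega>) \<le> norm (u \<omega> - c) + norm (v \<omega> - c)"
      using norm_triangle_ineq4[of "u \<omega> - c" "v \<omega> - c"] by simp
    then have "(norm (u \<omega> - v \<omega>))\<^sup>2 \<le> (norm (u \<omega> - c) + norm (v \<omega> - c))\<^sup>2"
      by (intro power_mono) auto
    also have "\<dots> \<le> 2 * (norm (u \<omega> - c))\<^sup>2 + 2 * (norm (v \<omega> - c))\<^sup>2"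
      using sum_squares_bound[of "norm (u \<omega> - c)" "norm (v \<omega> - c)"] by (simp add: power2_sum)
    finally show ?thesis .
  qed
  then show "AE \<omega> in M. norm ((norm (u \<omega> - v \<omega>))\<^sup>2)
      \<le> norm (2 * (norm (u \<omega> - c))\<^sup>2 + 2 * (norm (v \<omega> - c))\<^sup>2)"
    by simp
qed measurable

text \<open>As \<open>u\<close> lies in \<open>X\<close> it is its own projection, so
  nonexpansiveness applies; the rest is expanding a square.\<close>

lemma norm_projected_step_le:
  fixes X :: "'a::euclidean_space set"
  assumes "closed X" "convex X" "u \<in> X"
  shows "(norm (closest_point X (x - \<eta> *\<^sub>R h) - u))\<^sup>2
    \<le> (norm (x - u))\<^sup>2 - 2 * \<eta> * (h \<bullet> (x - u)) + \<eta>\<^sup>2 * (norm h)\<^sup>2"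
proof -
  have "dist (closest_point X (x - \<eta> *\<^sub>R h)) (closest_point X u) \<le> dist (x - \<eta> *\<^sub>R h) u"
    using assms by (intro closest_point_lipschitz) auto
  then have "norm (closest_point X (x - \<eta> *\<^sub>R h) - u) \<le> norm ((x - u) - \<eta> *\<^sub>R h)"
    using assms by (simp add: closest_point_self dist_norm algebra_simps)
  then have "(norm (closest_point X (x - \<eta> *\<^sub>R h) - u))\<^sup>2 \<le> (norm ((x - u) - \<eta> *\<^sub>R h))\<^sup>2"
    by (intro power_mono) auto
  also have "\<dots> = (norm (x - u))\<^sup>2 - 2 * \<eta> * (h \<bullet> (x - u)) + \<eta>\<^sup>2 * (norm h)\<^sup>2"
    unfolding power2_norm_eq_inner
    by (simp add: inner_diff_left inner_diff_right inner_commute algebra_simps power2_eq_square)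
  finally show ?thesis .
qed

section \<open>One projected step with a stochastic oracle\<close>

locale sgd_oracle = prob_space M for M :: "'w measure" +
  fixes D X :: "'a::euclidean_space set" and f :: "'a \<Rightarrow> real" and \<mu> :: real and xs :: 'a
    and F :: "nat \<Rightarrow> 'w measure" and orc :: "nat \<Rightarrow> 'a \<Rightarrow> 'w \<Rightarrow> 'a" and B :: real
  assumes closed_X: "closed X" and convex_X: "convex X" and X_subset_D: "X \<subseteq> D"
    and \<mu>_pos: "\<mu> > 0" and strongly_convex: "strongly_convex_on D X f \<mu>"
    and xs_in_X: "xs \<in> X" and xs_min: "\<And>x. x \<in> X \<Longrightarrow> f xs \<le> f x"
    and filtration_F: "filtration (space M) F" and subalgebra_F: "\<And>k. subalgebra M (F k)"
    and unbiased: "unbiased_oracle M F D X f orc" and bounded: "bounded_oracle M F X orc B"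
begin

lemma sigma_finite_subalgebra_F: "sigma_finite_subalgebra M (F k)"
  by (intro finite_measure_subalgebra_is_sigma_finite finite_measure_subalgebra.intro
      finite_measure_subalgebra_axioms.intro subalgebra_F) unfold_locales

text \<open>Query the constant point \<open>x\<close>: the conditional mean of the answer is almost
  surely a subgradient there, and in a probability space an almost sure event is nonempty.\<close>

lemma subdifferential_nonempty:
  assumes "x \<in> X"
  shows "subdifferential D f x \<noteq> {}"
proof
  assume empty: "subdifferential D f x = {}"
  have "(\<lambda>_. x) \<in> queries M (F 0) X"
    using assms by (simp add: queries_def)
  then have "AE \<omega> in M. False"
    using unbiased empty by (fastforce simp: unbiased_oracle_def)
  then show False by simp
qed

lemma query_measurable:
  assumes "q \<in> queries M (F k) X"
  shows "q \<in> borel_measurable M"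
  using assms measurable_from_subalg[OF subalgebra_F] by (auto simp: queries_def)

text \<open>Lets an earlier iterate serve as reference point at a later query.\<close>

lemma query_mono:
  assumes "q \<in> queries M (F j) X" and "j \<le> k"
  shows "q \<in> queries M (F k) X"
proof -
  have "subalgebra (F k) (F j)"
    using filtration.sets_F_mono[OF filtration_F \<open>j \<le> k\<close>] filtration.space_F[OF filtration_F]
    by (simp add: subalgebra_def)
  then show ?thesis
    using assms(1) measurable_from_subalg by (auto simp: queries_def)
qed

lemma const_query: "x \<in> X \<Longrightarrow> (\<lambda>_. x) \<in> queries M (F k) X"
  by (simp add: queries_def)

text \<open>Values of \<open>f\<close> outside \<open>X\<close> are arbitrary, so measurability
  passes through the modification that is 0 off \<open>X\<close>; it agrees with \<open>f\<close> on
  the range of \<open>q\<close>.\<close>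

lemma objective_measurable:
  assumes "q \<in> queries M (F k) X"
  shows "(\<lambda>\<omega>. f (q \<omega>)) \<in> borel_measurable M"
proof -
  have "(\<lambda>\<omega>. if q \<omega> \<in> X then f (q \<omega>) else 0) \<in> borel_measurable M"
    using measurable_compose[OF query_measurable[OF assms]
        borel_measurable_of_subgradients[OF borel_closed[OF closed_X] X_subset_D
          subdifferential_nonempty]] by simp
  then show ?thesis
    by (rule measurable_cong[THEN iffD1, rotated]) (use assms in \<open>auto simp: queries_def\<close>)
qed

context
  fixes q u :: "'w \<Rightarrow> 'a" and k :: nat
  assumes q: "q \<in> queries M (F k) X" and u: "u \<in> queries M (F k) X"
    and q2: "integrable M (\<lambda>\<omega>. (norm (q \<omega> - xs))\<^sup>2)"
    and u2: "integrable M (\<lambda>\<omega>. (norm (u \<omega> - xs))\<^sup>2)"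
begin

abbreviation answer :: "'w \<Rightarrow> 'a" where
  "answer \<equiv> (\<lambda>\<omega>. orc k (q \<omega>) \<omega>)"

lemma answer_measurable: "answer \<in> borel_measurable M"
  and answer_squared: "integrable M (\<lambda>\<omega>. (norm (answer \<omega>))\<^sup>2)"
    "(LINT \<omega>|M. (norm (answer \<omega>))\<^sup>2) \<le> B"
  using q unbiased bounded
  by (auto simp: unbiased_oracle_def bounded_oracle_def intro: borel_measurable_integrable)

lemma query_diff_squared_integrable: "integrable M (\<lambda>\<omega>. (norm (q \<omega> - u \<omega>))\<^sup>2)"
  by (rule integrable_norm_diff_squared[OF query_measurable[OF q] query_measurable[OF u] q2 u2])

lemma answer_inner:
  shows "integrable M (\<lambda>\<omega>. vec_cond_exp M (F k) answer \<omega> \<bullet> (q \<omega> - u \<omega>))"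
    and "integrable M (\<lambda>\<omega>. answer \<omega> \<bullet> (q \<omega> - u \<omega>))"
    and "(LINT \<omega>|M. vec_cond_exp M (F k) answer \<omega> \<bullet> (q \<omega> - u \<omega>)) = (LINT \<omega>|M. answer \<omega> \<bullet> (q \<omega> - u \<omega>))"
proof -
  have "(\<lambda>\<omega>. q \<omega> - u \<omega>) \<in> borel_measurable (F k)"
    using q u by (auto simp: queries_def)
  note sigma_finite_subalgebra.vec_cond_exp_inner[OF sigma_finite_subalgebra_F this
      answer_measurable answer_squared(1) query_diff_squared_integrable]
  then show "integrable M (\<lambda>\<omega>. vec_cond_exp M (F k) answer \<omega> \<bullet> (q \<omega> - u \<omega>))"
    and "integrable M (\<lambda>\<omega>. answer \<omega> \<bullet> (q \<omega> - u \<omega>))"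
    and "(LINT \<omega>|M. vec_cond_exp M (F k) answer \<omega> \<bullet> (q \<omega> - u \<omega>)) = (LINT \<omega>|M. answer \<omega> \<bullet> (q \<omega> - u \<omega>))"
    by auto
qed

lemma subgradient_inequality:
  "AE \<omega> in M. f (q \<omega>) - f (u \<omega>) + \<mu> / 2 * (norm (q \<omega> - u \<omega>))\<^sup>2
    \<le> vec_cond_exp M (F k) answer \<omega> \<bullet> (q \<omega> - u \<omega>)"
proof -
  have "AE \<omega> in M. vec_cond_exp M (F k) answer \<omega> \<in> subdifferential D f (q \<omega>)"
    using q unbiased by (auto simp: unbiased_oracle_def)
  then show ?thesis
  proof (rule AE_mp, intro AE_I2 impI)
    fix \<omega> assume "\<omega> \<in> space M"
      and g: "vec_cond_exp M (F k) answer \<omega> \<in> subdifferential D f (q \<omega>)"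
    then have "q \<omega> \<in> X" "u \<omega> \<in> X"
      using q u by (auto simp: queries_def)
    then have "f (u \<omega>) \<ge> f (q \<omega>) + vec_cond_exp M (F k) answer \<omega> \<bullet> (u \<omega> - q \<omega>)
        + \<mu> / 2 * (norm (u \<omega> - q \<omega>))\<^sup>2"
      using strongly_convex g by (auto simp: strongly_convex_on_def)
    then show "f (q \<omega>) - f (u \<omega>) + \<mu> / 2 * (norm (q \<omega> - u \<omega>))\<^sup>2
        \<le> vec_cond_exp M (F k) answer \<omega> \<bullet> (q \<omega> - u \<omega>)"
      by (simp add: inner_diff_right norm_minus_commute)
  qed
qed

text \<open>As \<open>q - u\<close> is known before the query, the answer can be traded for its
  conditional mean under the expectation. Strong convexity then yields the factor
  \<open>1 - \<mu> * \<eta>\<close> and the gap difference. The first part drives the induction that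
  makes all iterates square integrable.\<close>

lemma projected_step:
  fixes \<eta> :: real
  defines "q' \<equiv> \<lambda>\<omega>. closest_point X (q \<omega> - \<eta> *\<^sub>R answer \<omega>)"
  shows "integrable M (\<lambda>\<omega>. (norm (q' \<omega> - u \<omega>))\<^sup>2)"
    and "\<lbrakk>\<eta> \<ge> 0; integrable M (\<lambda>\<omega>. f (q \<omega>) - f xs); integrable M (\<lambda>\<omega>. f (u \<omega>) - f xs)\<rbrakk> \<Longrightarrow>
      (LINT \<omega>|M. (norm (q' \<omega> - u \<omega>))\<^sup>2) \<le> (1 - \<mu> * \<eta>) * (LINT \<omega>|M. (norm (q \<omega> - u \<omega>))\<^sup>2)
        - 2 * \<eta> * ((LINT \<omega>|M. f (q \<omega>) - f xs) - (LINT \<omega>|M. f (u \<omega>) - f xs)) + \<eta>\<^sup>2 * B"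
proof -
  have [measurable]: "q \<in> borel_measurable M" "u \<in> borel_measurable M" "answer \<in> borel_measurable M"
    using query_measurable q u answer_measurable by auto
  have [measurable]: "closest_point X \<in> borel_measurable borel"
    using xs_in_X by (intro borel_measurable_continuous_onI continuous_on_closest_point convex_X closed_X) auto
  have [measurable]: "q' \<in> borel_measurable M"
    unfolding q'_def by measurable
  let ?bound = "\<lambda>\<omega>. (norm (q \<omega> - u \<omega>))\<^sup>2 - 2 * \<eta> * (answer \<omega> \<bullet> (q \<omega> - u \<omega>)) + \<eta>\<^sup>2 * (norm (answer \<omega>))\<^sup>2"
  have le: "(norm (q' \<omega> - u \<omega>))\<^sup>2 \<le> ?bound \<omega>" if "\<omega> \<in> space M" for \<omega>
    unfolding q'_def using that u by (intro norm_projected_step_le closed_X convex_X) (auto simp: queries_def)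
  have int_bound: "integrable M ?bound"
    using query_diff_squared_integrable answer_inner answer_squared by simp
  show int: "integrable M (\<lambda>\<omega>. (norm (q' \<omega> - u \<omega>))\<^sup>2)"
  proof (rule Bochner_Integration.integrable_bound[OF int_bound])
    show "AE \<omega> in M. norm ((norm (q' \<omega> - u \<omega>))\<^sup>2) \<le> norm (?bound \<omega>)"
      using le by (intro AE_I2) fastforce
  qed measurable
  assume "\<eta> \<ge> 0" and fq: "integrable M (\<lambda>\<omega>. f (q \<omega>) - f xs)" and fu: "integrable M (\<lambda>\<omega>. f (u \<omega>) - f xs)"
  have "(LINT \<omega>|M. f (q \<omega>) - f xs - (f (u \<omega>) - f xs) + \<mu> / 2 * (norm (q \<omega> - u \<omega>))\<^sup>2)
      \<le> (LINT \<omega>|M. vec_cond_exp M (F k) answer \<omega> \<bullet> (q \<omega> - u \<omega>))"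
  proof (rule integral_mono_AE)
    show "integrable M (\<lambda>\<omega>. f (q \<omega>) - f xs - (f (u \<omega>) - f xs) + \<mu> / 2 * (norm (q \<omega> - u \<omega>))\<^sup>2)"
      by (intro Bochner_Integration.integrable_add Bochner_Integration.integrable_diff
          integrable_mult_right fq fu query_diff_squared_integrable)
  qed (use answer_inner subgradient_inequality in auto)
  \<comment> \<open>Linearity for arbitrary integrands, so that each gap
    \<open>f (q \<omega>) - f xs\<close> stays whole under its integral.\<close>
  moreover have "(LINT \<omega>|M. \<phi> \<omega> - \<psi> \<omega> + \<mu> / 2 * d \<omega>)
      = (LINT \<omega>|M. \<phi> \<omega>) - (LINT \<omega>|M. \<psi> \<omega>) + \<mu> / 2 * (LINT \<omega>|M. d \<omega>)"
    if "integrable M \<phi>" "integrable M \<psi>" "integrable M d" for \<phi> \<psi> d :: "'w \<Rightarrow> real"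
    using that by simp
  note this[OF fq fu query_diff_squared_integrable]
  ultimately have "(LINT \<omega>|M. f (q \<omega>) - f xs) - (LINT \<omega>|M. f (u \<omega>) - f xs)
      + \<mu> / 2 * (LINT \<omega>|M. (norm (q \<omega> - u \<omega>))\<^sup>2) \<le> (LINT \<omega>|M. answer \<omega> \<bullet> (q \<omega> - u \<omega>))"
    (is "?\<Delta> + _ * ?d \<le> ?s")
    by (simp only: answer_inner(3))
  then have "2 * \<eta> * (?\<Delta> + \<mu> / 2 * ?d) \<le> 2 * \<eta> * ?s"
    using \<open>\<eta> \<ge> 0\<close> by (intro mult_left_mono) auto
  moreover have "(LINT \<omega>|M. (norm (q' \<omega> - u \<omega>))\<^sup>2) \<le> (LINT \<omega>|M. ?bound \<omega>)"
    using int int_bound le by (rule integral_mono)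
  moreover have "(LINT \<omega>|M. ?bound \<omega>) = ?d - 2 * \<eta> * ?s + \<eta>\<^sup>2 * (LINT \<omega>|M. (norm (answer \<omega>))\<^sup>2)"
    using query_diff_squared_integrable answer_inner answer_squared by simp
  moreover have "\<eta>\<^sup>2 * (LINT \<omega>|M. (norm (answer \<omega>))\<^sup>2) \<le> \<eta>\<^sup>2 * B"
    using answer_squared by (intro mult_left_mono) auto
  ultimately show "(LINT \<omega>|M. (norm (q' \<omega> - u \<omega>))\<^sup>2) \<le> (1 - \<mu> * \<eta>) * ?d - 2 * \<eta> * ?\<Delta> + \<eta>\<^sup>2 * B"
    by (simp add: algebra_simps)
qed

end

text \<open>The gap is nonnegative by minimality and, by the subgradient inequality with
  \<open>u = xs\<close>, almost surely at most an integrable inner product.\<close>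

lemma objective_gap_integrable:
  assumes q: "q \<in> queries M (F k) X" and q2: "integrable M (\<lambda>\<omega>. (norm (q \<omega> - xs))\<^sup>2)"
  shows "integrable M (\<lambda>\<omega>. f (q \<omega>) - f xs)"
proof -
  note xs = const_query[OF xs_in_X, of k]
  have xs2: "integrable M (\<lambda>\<omega>. (norm (xs - xs))\<^sup>2)" by simp
  show ?thesis
  proof (rule Bochner_Integration.integrable_bound[OF answer_inner(1)[OF q xs q2 xs2]])
    show "(\<lambda>\<omega>. f (q \<omega>) - f xs) \<in> borel_measurable M"
      using objective_measurable[OF q] by simp
    show "AE \<omega> in M. norm (f (q \<omega>) - f xs)
        \<le> norm (vec_cond_exp M (F k) (\<lambda>\<omega>. orc k (q \<omega>) \<omega>) \<omega> \<bullet> (q \<omega> - xs))"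
      using subgradient_inequality[OF q xs q2 xs2]
    proof (rule AE_mp, intro AE_I2 impI)
      fix \<omega> assume "\<omega> \<in> space M"
        and le: "f (q \<omega>) - f xs + \<mu> / 2 * (norm (q \<omega> - xs))\<^sup>2
          \<le> vec_cond_exp M (F k) (\<lambda>\<omega>. orc k (q \<omega>) \<omega>) \<omega> \<bullet> (q \<omega> - xs)"
      then have "f xs \<le> f (q \<omega>)" "0 \<le> \<mu> / 2 * (norm (q \<omega> - xs))\<^sup>2"
        using q xs_min \<mu>_pos by (auto simp: queries_def)
      with le show "norm (f (q \<omega>) - f xs)
          \<le> norm (vec_cond_exp M (F k) (\<lambda>\<omega>. orc k (q \<omega>) \<omega>) \<omega> \<bullet> (q \<omega> - xs))"
        unfolding real_norm_def by linarith
    qed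
  qed
qed

lemma quadratic_growth_expectation:
  assumes q: "q \<in> queries M (F k) X" and q2: "integrable M (\<lambda>\<omega>. (norm (q \<omega> - xs))\<^sup>2)"
  shows "\<mu> / 2 * (LINT \<omega>|M. (norm (q \<omega> - xs))\<^sup>2) \<le> (LINT \<omega>|M. f (q \<omega>) - f xs)"
proof -
  have "(LINT \<omega>|M. \<mu> / 2 * (norm (q \<omega> - xs))\<^sup>2) \<le> (LINT \<omega>|M. f (q \<omega>) - f xs)"
    using q q2 objective_gap_integrable[OF q q2] convex_X strongly_convex subdifferential_nonempty xs_in_X xs_min
    by (intro integral_mono strongly_convex_on_quadratic_growth) (auto simp: queries_def)
  then show ?thesis by simp
qed

end

section \<open>Telescoping and flattening of the two loops\<close>

text \<open>Telescoping with a constant step \<open>h\<close> against a reference level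
  \<open>p\<close>: later the gap of a reference iterate, or 0 when the reference point is the
  minimizer.\<close>

lemma sum_le_of_descent:
  fixes e \<phi> :: "nat \<Rightarrow> real"
  assumes "j \<le> s"
    and step: "\<And>i. j \<le> i \<Longrightarrow> i < s \<Longrightarrow> e (Suc i) \<le> e i - 2 * h * (\<phi> i - p) + h\<^sup>2 * B"
  shows "e s + 2 * h * (\<Sum>i\<in>{j..<s}. \<phi> i) \<le> e j + real (s - j) * (2 * h * p + h\<^sup>2 * B)"
  using assms
proof (induction s rule: dec_induct)
  case (step s)
  have "e (Suc s) \<le> e s - 2 * h * (\<phi> s - p) + h\<^sup>2 * B"
    using step by simp
  moreover have "e s + 2 * h * (\<Sum>i\<in>{j..<s}. \<phi> i) \<le> e j + real (s - j) * (2 * h * p + h\<^sup>2 * B)"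
    using step by simp
  ultimately show ?case
    using step.hyps by (simp add: algebra_simps Suc_diff_le)
qed simp

text \<open>Projected SGD with one running index, so that indices are query numbers and stages show
  only in the step-sizes.\<close>

primrec sgd_iterate ::
  "'a::euclidean_space set \<Rightarrow> (nat \<Rightarrow> real) \<Rightarrow> (nat \<Rightarrow> 'a \<Rightarrow> 'a) \<Rightarrow> 'a \<Rightarrow> nat \<Rightarrow> 'a" where
  "sgd_iterate X \<eta> ans x 0 = x"
| "sgd_iterate X \<eta> ans x (Suc k) =
     closest_point X (sgd_iterate X \<eta> ans x k - \<eta> k *\<^sub>R ans k (sgd_iterate X \<eta> ans x k))"

lemma inner_loop_eq_sgd_iterate:
  assumes "\<And>j. j < i \<Longrightarrow> \<eta> (m + j) = h"
  shows "inner_loop X h (\<lambda>j. ans (m + j)) (sgd_iterate X \<eta> ans x m) i = sgd_iterate X \<eta> ans x (m + i)"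
  using assms by (induction i) (simp_all add: Let_def)

lemma stage_start_eq_sgd_iterate:
  "stage_start X \<eta>0 \<alpha> S ans x t = sgd_iterate X (\<lambda>k. \<eta>0 / \<alpha> ^ (k div S)) ans x (t * S)"
proof (induction t)
  case (Suc t)
  then show ?case
    using inner_loop_eq_sgd_iterate[of S "\<lambda>k. \<eta>0 / \<alpha> ^ (k div S)" "t * S" "\<eta>0 / \<alpha> ^ t" X ans x]
    by (simp add: add.commute)
qed simp

text \<open>At most \<open>S - 1\<close> steps of stage \<open>t\<close> are taken, so all their
  indices \<open>k\<close> satisfy \<open>k div S = t - 1\<close>.\<close>

lemma step_decay_sgd_eq_sgd_iterate:
  assumes "t \<ge> 1" "i \<in> {1..S}"
  shows "step_decay_sgd X \<eta>0 \<alpha> S orc x t i =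
    (\<lambda>\<omega>. sgd_iterate X (\<lambda>k. \<eta>0 / \<alpha> ^ (k div S)) (\<lambda>j y. orc j y \<omega>) x ((t - 1) * S + (i - 1)))"
  unfolding step_decay_sgd_def stage_start_eq_sgd_iterate
  using assms by (intro ext inner_loop_eq_sgd_iterate) auto

declare sgd_iterate.simps(2) [simp del]

section \<open>Error recursion and last-iterate bound\<close>

context sgd_oracle
begin

context
  fixes x0 :: 'a and \<eta> :: "nat \<Rightarrow> real" and n :: nat
  assumes x0: "x0 \<in> X" and \<eta>_nonneg: "\<And>k. 0 \<le> \<eta> k"
    and adapted: "\<And>k. k < n \<Longrightarrow>
      (\<lambda>\<omega>. sgd_iterate X \<eta> (\<lambda>j y. orc j y \<omega>) x0 k) \<in> borel_measurable (F k)"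
begin

abbreviation Z :: "nat \<Rightarrow> 'w \<Rightarrow> 'a" where
  "Z k \<equiv> (\<lambda>\<omega>. sgd_iterate X \<eta> (\<lambda>j y. orc j y \<omega>) x0 k)"

abbreviation gap :: "nat \<Rightarrow> real" where
  "gap k \<equiv> (LINT \<omega>|M. f (Z k \<omega>) - f xs)"

abbreviation error :: "nat \<Rightarrow> real" where
  "error k \<equiv> (LINT \<omega>|M. (norm (Z k \<omega> - xs))\<^sup>2)"

lemma iterate_in_X: "Z k \<omega> \<in> X"
  by (cases k) (use x0 closed_X closest_point_in_set in \<open>auto simp: sgd_iterate.simps\<close>)

lemma iterate_query: "k < n \<Longrightarrow> Z k \<in> queries M (F k) X"
  using adapted iterate_in_X by (simp add: queries_def)

text \<open>The range includes \<open>n\<close>, because \<open>Z n\<close> is produced by query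
  \<open>n - 1\<close>, whose point is still adapted.\<close>

lemma iterate_error_integrable: "k \<le> n \<Longrightarrow> integrable M (\<lambda>\<omega>. (norm (Z k \<omega> - xs))\<^sup>2)"
proof (induction k)
  case (Suc k)
  then show ?case
    using projected_step(1)[OF iterate_query const_query[OF xs_in_X], of k "\<eta> k"]
    by (simp add: sgd_iterate.simps(2))
qed simp

lemma iterate_gap_integrable: "k < n \<Longrightarrow> integrable M (\<lambda>\<omega>. f (Z k \<omega>) - f xs)"
  by (intro objective_gap_integrable[OF iterate_query] iterate_error_integrable) auto

text \<open>The reference point \<open>Z j\<close> is known before query \<open>k\<close>. The
  contraction term has a favourable sign and is dropped.\<close>

lemma iterate_step:
  assumes "j \<le> k" "k < n"
  shows "(LINT \<omega>|M. (norm (Z (Suc k) \<omega> - Z j \<omega>))\<^sup>2) \<le> (LINT \<omega>|M. (norm (Z k \<omega> - Z j \<omega>))\<^sup>2)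
    - 2 * \<eta> k * (gap k - gap j) + (\<eta> k)\<^sup>2 * B"
proof -
  have "(LINT \<omega>|M. (norm (Z (Suc k) \<omega> - Z j \<omega>))\<^sup>2)
    \<le> (1 - \<mu> * \<eta> k) * (LINT \<omega>|M. (norm (Z k \<omega> - Z j \<omega>))\<^sup>2) - 2 * \<eta> k * (gap k - gap j) + (\<eta> k)\<^sup>2 * B"
    using projected_step(2)[OF iterate_query[OF assms(2)] query_mono[OF iterate_query assms(1)]
        iterate_error_integrable iterate_error_integrable \<eta>_nonneg iterate_gap_integrable iterate_gap_integrable]
      assms by (simp add: sgd_iterate.simps(2))
  moreover have "0 \<le> \<mu> * \<eta> k * (LINT \<omega>|M. (norm (Z k \<omega> - Z j \<omega>))\<^sup>2)"
    using \<mu>_pos \<eta>_nonneg by simp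
  ultimately show ?thesis by (simp add: algebra_simps)
qed

lemma error_step_gap:
  assumes "k < n"
  shows "error (Suc k) \<le> (1 - \<mu> * \<eta> k) * error k - 2 * \<eta> k * gap k + (\<eta> k)\<^sup>2 * B"
  using projected_step(2)[OF iterate_query[OF assms] const_query[OF xs_in_X]
      iterate_error_integrable _ \<eta>_nonneg iterate_gap_integrable] assms
  by (simp add: sgd_iterate.simps(2))

lemma gap_ge_error: "k < n \<Longrightarrow> \<mu> / 2 * error k \<le> gap k"
  by (intro quadratic_growth_expectation[OF iterate_query] iterate_error_integrable) auto

text \<open>Strong convexity enters twice, directly in the step and through quadratic growth of the
  gap; each contributes \<open>\<mu> * \<eta> k\<close> to the contraction.\<close>

lemma error_step:
  assumes "k < n"
  shows "error (Suc k) \<le> (1 - 2 * \<mu> * \<eta> k) * error k + (\<eta> k)\<^sup>2 * B"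
  using error_step_gap[OF assms] mult_left_mono[OF gap_ge_error[OF assms], of "2 * \<eta> k"] \<eta>_nonneg[of k]
  by (simp add: algebra_simps)

text \<open>\<open>h * B / (2 * \<mu>)\<close> is a fixed point of
  \<open>e \<mapsto> (1 - 2 * \<mu> * h) * e + h\<^sup>2 * B\<close>; subtracting it makes the
  recursion homogeneous.\<close>

lemma stage_contraction:
  assumes "m + s \<le> n" and h: "\<And>i. i < s \<Longrightarrow> \<eta> (m + i) = h" and "2 * \<mu> * h \<le> 1"
  shows "error (m + s) - h * B / (2 * \<mu>) \<le> (1 - 2 * \<mu> * h) ^ s * (error m - h * B / (2 * \<mu>))"
proof -
  have "error (m + Suc i) - h * B / (2 * \<mu>) \<le> (1 - 2 * \<mu> * h) * (error (m + i) - h * B / (2 * \<mu>))"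
    if "i < s" for i
  proof -
    have "error (m + Suc i) \<le> (1 - 2 * \<mu> * h) * error (m + i) + h\<^sup>2 * B"
      using error_step[of "m + i"] h[OF that] assms that by simp
    also have "h\<^sup>2 * B = 2 * \<mu> * h * (h * B / (2 * \<mu>))"
      using \<mu>_pos by (simp add: power2_eq_square)
    finally show ?thesis
      by (simp only: left_diff_distrib right_diff_distrib mult_1_left)
  qed
  then show ?thesis
    using affine_recursion_le[of "1 - 2 * \<mu> * h" s "\<lambda>i. error (m + i)" "h * B / (2 * \<mu>)"] assms
    by simp
qed

text \<open>Taking \<open>Z (m + j)\<close> as reference point compares each tail sum of gaps with
  its first gap, as \<open>last_le_average_plus_harm\<close> requires; the full average is bounded
  with reference point \<open>xs\<close>.\<close>

lemma last_iterate_gap_le: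
  assumes "m + s \<le> n" and "s \<ge> 1" and h: "\<And>i. i < s \<Longrightarrow> \<eta> (m + i) = h" and "h > 0"
  shows "gap (m + (s - 1)) \<le> error m / (2 * real s * h) + h * B / 2 * (1 + harm (s - 1))"
proof -
  have "gap (m + (s - 1)) \<le> (\<Sum>i<s. gap (m + i)) / real s + h * B / 2 * harm (s - 1)"
  proof (rule last_le_average_plus_harm[OF \<open>s \<ge> 1\<close>])
    fix j assume "j < s"
    let ?e = "\<lambda>i. LINT \<omega>|M. (norm (Z (m + i) \<omega> - Z (m + j) \<omega>))\<^sup>2"
    have "?e s + 2 * h * (\<Sum>i\<in>{j..<s}. gap (m + i))
        \<le> ?e j + real (s - j) * (2 * h * gap (m + j) + h\<^sup>2 * B)"
    proof (rule sum_le_of_descent)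
      fix i assume "j \<le> i" "i < s"
      then show "?e (Suc i) \<le> ?e i - 2 * h * (gap (m + i) - gap (m + j)) + h\<^sup>2 * B"
        using iterate_step[of "m + j" "m + i"] h assms by simp
    qed (use \<open>j < s\<close> in simp)
    \<comment> \<open>At index \<open>m + j\<close> the iterate is the reference point itself, so
      the initial distance vanishes.\<close>
    moreover have "?e s \<ge> 0" "?e j = 0" by simp_all
    ultimately have "2 * h * (\<Sum>i\<in>{j..<s}. gap (m + i)) \<le> real (s - j) * (2 * h * gap (m + j) + h\<^sup>2 * B)"
      by linarith
    also have "real (s - j) * (2 * h * g + h\<^sup>2 * B) = 2 * h * (real (s - j) * (g + h * B / 2))" for g
      by (simp add: algebra_simps power2_eq_square)
    finally show "(\<Sum>i\<in>{j..<s}. gap (m + i)) \<le> real (s - j) * (gap (m + j) + h * B / 2)"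
      using \<open>h > 0\<close> by simp
  qed
  moreover have "(\<Sum>i<s. gap (m + i)) / real s \<le> error m / (2 * real s * h) + h * B / 2"
  proof -
    have "error (m + s) + 2 * h * (\<Sum>i\<in>{0..<s}. gap (m + i))
        \<le> error (m + 0) + real (s - 0) * (2 * h * 0 + h\<^sup>2 * B)"
    proof (rule sum_le_of_descent)
      fix i assume "i < s"
      moreover have "0 \<le> \<mu> * h * error (m + i)"
        using \<mu>_pos \<open>h > 0\<close> by simp
      ultimately show "error (m + Suc i) \<le> error (m + i) - 2 * h * (gap (m + i) - 0) + h\<^sup>2 * B"
        using error_step_gap[of "m + i"] h[of i] assms by (simp add: algebra_simps)
    qed simp
    then have "error (m + s) + 2 * h * (\<Sum>i<s. gap (m + i)) \<le> error m + real s * (h\<^sup>2 * B)"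
      by (simp add: lessThan_atLeast0)
    moreover have "error (m + s) \<ge> 0" by simp
    ultimately have "2 * h * (\<Sum>i<s. gap (m + i)) \<le> error m + real s * (h\<^sup>2 * B)"
      by linarith
    then have "2 * h * (\<Sum>i<s. gap (m + i)) / (2 * real s * h)
        \<le> (error m + real s * (h\<^sup>2 * B)) / (2 * real s * h)"
      using \<open>h > 0\<close> by (intro divide_right_mono) auto
    then show ?thesis
      using \<open>s \<ge> 1\<close> \<open>h > 0\<close> by (simp add: add_divide_distrib power2_eq_square)
  qed
  ultimately show ?thesis
    unfolding distrib_left mult_1_right by linarith
qed

end

end

section \<open>Final estimate\<close>

text \<open>Here \<open>a\<close> is the error at the start of the last stage, \<open>\<phi>\<close>
  the final gap, and \<open>L\<close>, \<open>l\<close> stand for \<open>ln T\<close>,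
  \<open>ln \<alpha>\<close>. The estimates leave a factor of 2 to spare in each of the three
  terms.\<close>

lemma step_decay_final_bound:
  fixes a \<phi> R G \<mu> \<eta>0 \<alpha> T S L l H :: real
  assumes pos: "\<mu> > 0" "\<eta>0 > 0" "\<alpha> > 1" "T > 0" "L > 0" "l > 0" "R \<ge> 0"
    and S: "S = T * l / L" and h: "h = \<eta>0 * \<alpha> / T"
    and c: "c = 2 * \<mu> * S * \<eta>0 * \<alpha> / (\<alpha> - 1)" and K: "K = (\<alpha> - 1) * G\<^sup>2 / (4 * \<mu>\<^sup>2 * S)"
    and a: "a \<le> exp (c * \<alpha> / T - c) * R + K * (1 + c * \<alpha> / T)"
    and \<phi>: "\<phi> \<le> a / (2 * S * h) + h * G\<^sup>2 / 2 * (1 + H)" and "H \<le> 1 + L"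
    and A: "A = \<eta>0 * \<alpha> * l" and B: "B = 2 * \<mu> * A / (\<alpha> - 1)"
  shows "\<phi> \<le> R * L / (A * exp (B * ((T - \<alpha>) / L))) + G\<^sup>2 * \<eta>0 * \<alpha> * ((L + 2) / T)
    + G\<^sup>2 / (2 * \<mu> * l * B) * exp (\<alpha> * B / L) * (L\<^sup>2 / T)"
proof -
  have "S > 0" "h > 0" "A > 0" "B > 0" "K \<ge> 0" "1 / (2 * A) > 0"
    using pos by (simp_all add: S h A B K)
  have cB: "c = B * T / L"
    using pos by (simp add: c S A B field_simps)
  have c1: "c * \<alpha> / T = \<alpha> * B / L" and c2: "c * \<alpha> / T - c = - (B * ((T - \<alpha>) / L))"
    unfolding cB using pos by (simp_all add: field_simps)
  have Sh: "a / (2 * S * h) = a * (L / (2 * A))"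
    using pos by (simp add: S h A field_simps)
  \<comment> \<open>\<open>1 + x \<le> exp x\<close> at \<open>x = \<alpha> * B / L\<close> is the
    source of the exponential in the last term.\<close>
  have "a \<le> exp (- (B * ((T - \<alpha>) / L))) * R + K * exp (\<alpha> * B / L)"
    using a unfolding c2 unfolding c1
    by (rule order_trans) (use \<open>K \<ge> 0\<close> in \<open>auto intro!: mult_left_mono simp: exp_ge_add_one_self\<close>)
  then have "a * (L / (2 * A)) \<le> (exp (- (B * ((T - \<alpha>) / L))) * R + K * exp (\<alpha> * B / L)) * (L / (2 * A))"
    using \<open>A > 0\<close> \<open>L > 0\<close> by (intro mult_right_mono) auto
  also have "\<dots> = (R * L / (A * exp (B * ((T - \<alpha>) / L)))) / 2 + K * (L / (2 * A)) * exp (\<alpha> * B / L)"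
    using \<open>A > 0\<close> by (simp add: exp_minus field_simps)
  also have "K * (L / (2 * A)) = (G\<^sup>2 / (2 * \<mu> * l * B) * (L\<^sup>2 / T)) / 2"
    using pos by (simp add: K A B S field_simps power2_eq_square)
  finally have 1: "a * (L / (2 * A)) \<le> (R * L / (A * exp (B * ((T - \<alpha>) / L)))) / 2
      + (G\<^sup>2 / (2 * \<mu> * l * B) * exp (\<alpha> * B / L) * (L\<^sup>2 / T)) / 2"
    by (simp add: mult_ac)
  have "h * G\<^sup>2 / 2 * (1 + H) \<le> h * G\<^sup>2 / 2 * (2 * (L + 2))"
    using \<open>H \<le> 1 + L\<close> \<open>L > 0\<close> \<open>h > 0\<close> by (intro mult_left_mono) auto
  also have "\<dots> = G\<^sup>2 * \<eta>0 * \<alpha> * ((L + 2) / T)"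
    by (simp add: h add_divide_distrib distrib_left mult_ac)
  finally have 2: "h * G\<^sup>2 / 2 * (1 + H) \<le> G\<^sup>2 * \<eta>0 * \<alpha> * ((L + 2) / T)" .
  have nonneg: "0 \<le> R * L / (A * exp (B * ((T - \<alpha>) / L)))"
    "0 \<le> G\<^sup>2 / (2 * \<mu> * l * B) * exp (\<alpha> * B / L) * (L\<^sup>2 / T)"
    using pos \<open>A > 0\<close> \<open>B > 0\<close> by simp_all
  have combine: "z \<le> r + e + d" if "x \<le> r / 2 + d / 2" "y \<le> e" "z \<le> x + y" "0 \<le> r" "0 \<le> d"
    for x y z r d e :: real
    using that by linarith
  show ?thesis
    using combine[OF 1 2 \<phi>[unfolded Sh] nonneg] .
qed

text \<open>The integral of a non-integrable function is 0 by convention, so integrability is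
  asserted alongside the bound. \<open>adapted\<close> ties the filtration to the algorithm: each
  query point is determined by the past of its query.\<close>

theorem theorem5p3:
  fixes D X :: "'a::euclidean_space set" and f :: "'a \<Rightarrow> real"
    and M :: "'w measure" and F :: "nat \<Rightarrow> 'w measure" and orc :: "nat \<Rightarrow> 'a \<Rightarrow> 'w \<Rightarrow> 'a"
    and x1 xs :: 'a and \<mu> G \<eta>0 \<alpha> :: real and T S N :: nat
  assumes "closed X" and "convex X" and "X \<subseteq> D"
    and "\<mu> > 0" and "strongly_convex_on D X f \<mu>"
    and minimizer: "{x. is_arg_min f (\<lambda>x. x \<in> X) x} = {xs}"
    and "prob_space M" and "filtration (space M) F" and "\<And>k. subalgebra M (F k)"
    and "G > 0" and "unbiased_oracle M F D X f orc" and "bounded_oracle M F X orc (G\<^sup>2)"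
    and adapted: "\<And>t i. t \<in> {1..N} \<Longrightarrow> i \<in> {1..S} \<Longrightarrow>
      step_decay_sgd X \<eta>0 \<alpha> S orc x1 t i \<in> borel_measurable (F ((t - 1) * S + (i - 1)))"
    and "T > 1" and "\<alpha> > 1"
    and "N \<ge> 1" and "real N = log \<alpha> (real T)"
    and "S \<ge> 1" and "real S = real T / log \<alpha> (real T)"
    and "x1 \<in> X" and "0 < \<eta>0" and "\<eta>0 < 1 / (2 * \<mu>)"
  shows "integrable M (\<lambda>\<omega>. f (step_decay_sgd X \<eta>0 \<alpha> S orc x1 N S \<omega>) - f xs) \<and>
    (let R = (norm (x1 - xs))\<^sup>2;
         A4 = \<eta>0 * \<alpha> * ln \<alpha>;
         B4 = 2 * \<mu> * A4 / (\<alpha> - 1);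
         C4 = G\<^sup>2 * \<eta>0 * \<alpha>;
         D4 = G\<^sup>2 / (2 * \<mu> * ln \<alpha> * B4);
         E4 = \<alpha> * B4
     in (LINT \<omega>|M. f (step_decay_sgd X \<eta>0 \<alpha> S orc x1 N S \<omega>) - f xs)
          \<le> R * ln (real T) / (A4 * exp (B4 * ((real T - \<alpha>) / ln (real T))))
            + C4 * ((ln (real T) + 2) / real T)
            + D4 * exp (E4 / ln (real T)) * ((ln (real T))\<^sup>2 / real T))"
proof -
  interpret prob_space M by fact
  have "xs \<in> {x. is_arg_min f (\<lambda>x. x \<in> X) x}"
    using minimizer by simp
  then have "xs \<in> X" and xs_min: "\<And>x. x \<in> X \<Longrightarrow> f xs \<le> f x"
    by (auto simp: is_arg_min_def not_less)
  interpret sgd_oracle M D X f \<mu> xs F orc "G\<^sup>2"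
    using assms \<open>xs \<in> X\<close> xs_min by (intro sgd_oracle.intro sgd_oracle_axioms.intro) auto
  define L l where "L = ln (real T)" and "l = ln \<alpha>"
  have "L > 0" "l > 0"
    using \<open>T > 1\<close> \<open>\<alpha> > 1\<close> by (simp_all add: L_def l_def)
  have S: "real S = real T * l / L"
    using assms by (simp add: log_def L_def l_def)
  have "real N * real S = real T"
    using \<open>real N = log \<alpha> (real T)\<close> \<open>L > 0\<close> \<open>l > 0\<close> unfolding S by (simp add: log_def L_def l_def)
  then have "real S \<le> real T"
    using \<open>N \<ge> 1\<close> by (metis mult_1 mult_right_mono of_nat_0_le_iff of_nat_1 of_nat_le_iff)
  \<comment> \<open>\<open>N = log \<alpha> T\<close> means \<open>\<alpha> ^ N = T\<close>, so the
    last stage has step-size \<open>\<eta>0 * \<alpha> / T\<close>.\<close>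
  have "\<alpha> ^ N = \<alpha> powr real N"
    using \<open>\<alpha> > 1\<close> by (simp add: powr_realpow)
  also have "\<dots> = real T"
    unfolding \<open>real N = log \<alpha> (real T)\<close> using \<open>\<alpha> > 1\<close> \<open>T > 1\<close> by simp
  finally have \<alpha>N: "\<alpha> ^ (N - 1) = real T / \<alpha>"
    using \<open>N \<ge> 1\<close> \<open>\<alpha> > 1\<close> by (cases N) (auto simp: field_simps)

  define \<eta> where "\<eta> = (\<lambda>k. \<eta>0 / \<alpha> ^ (k div S))"
  have \<eta>_nonneg: "0 \<le> \<eta> k" for k
    using assms by (simp add: \<eta>_def)
  have \<eta>_stage: "\<eta> (t * S + i) = \<eta>0 / \<alpha> ^ t" if "i < S" for t i
    using that by (simp add: \<eta>_def)
  have ad: "(\<lambda>\<omega>. sgd_iterate X \<eta> (\<lambda>j y. orc j y \<omega>) x1 k) \<in> borel_measurable (F k)" if "k < N * S" for k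
  proof -
    \<comment> \<open>Stages and iterates are counted from 1, query numbers from 0.\<close>
    have "k div S + 1 \<in> {1..N}" "k mod S + 1 \<in> {1..S}"
      using that \<open>S \<ge> 1\<close> by (auto simp: less_mult_imp_div_less Suc_le_eq)
    from adapted[OF this] show ?thesis
      using \<open>k mod S + 1 \<in> {1..S}\<close> by (simp add: step_decay_sgd_eq_sgd_iterate \<eta>_def)
  qed
  define Z where "Z = (\<lambda>k \<omega>. sgd_iterate X \<eta> (\<lambda>j y. orc j y \<omega>) x1 k)"
  define err where "err = (\<lambda>k. LINT \<omega>|M. (norm (Z k \<omega> - xs))\<^sup>2)"
  define gp where "gp = (\<lambda>k. LINT \<omega>|M. f (Z k \<omega>) - f xs)"
  note gap_integrable = iterate_gap_integrable[OF \<open>x1 \<in> X\<close> \<eta>_nonneg ad]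
  note contraction = stage_contraction[OF \<open>x1 \<in> X\<close> \<eta>_nonneg ad, of "N * S"]
  note last_gap = last_iterate_gap_le[OF \<open>x1 \<in> X\<close> \<eta>_nonneg ad, of "N * S"]

  \<comment> \<open>With \<open>t\<close> counted from 0, \<open>c\<close> makes stage
    \<open>t\<close> contract by at least
    \<open>exp (c / \<alpha> ^ (t + 1) - c / \<alpha> ^ t)\<close>, and \<open>K\<close> makes its
    stationary noise level \<open>K * (c / \<alpha> ^ (t + 1))\<close>.\<close>
  define c where "c = 2 * \<mu> * real S * \<eta>0 * \<alpha> / (\<alpha> - 1)"
  define K where "K = (\<alpha> - 1) * G\<^sup>2 / (4 * \<mu>\<^sup>2 * real S)"
  have stage_le: "t * S + S \<le> N * S" if "t < N" for t
    using that mult_le_mono1[of "Suc t" N S] by (simp add: add.commute)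
  have "err ((N - 1) * S) \<le> exp (c / \<alpha> ^ (N - 1) - c) * err (0 * S) + K * (1 + c / \<alpha> ^ (N - 1))"
  proof (rule step_decay_recursion_le[where \<rho> = "\<lambda>t. (1 - 2 * \<mu> * (\<eta>0 / \<alpha> ^ t)) ^ S"])
    fix t assume "t < N - 1"
    define h where "h = \<eta>0 / \<alpha> ^ t"
    have "h \<le> \<eta>0" unfolding h_def
      using assms one_le_power[of \<alpha> t] by (simp add: divide_le_eq mult_le_cancel_left1)
    \<comment> \<open>The bound on \<open>\<eta>0\<close> keeps every factor
      \<open>1 - 2 * \<mu> * h\<close> nonnegative.\<close>
    then have "2 * \<mu> * h \<le> 2 * \<mu> * \<eta>0"
      using \<open>\<mu> > 0\<close> by simp
    also have "\<dots> < 1"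
      using assms by (simp add: field_simps)
    finally have h1: "2 * \<mu> * h \<le> 1" by simp
    then show "0 \<le> (1 - 2 * \<mu> * (\<eta>0 / \<alpha> ^ t)) ^ S"
      by (simp add: h_def)
    have "(1 - 2 * \<mu> * h) ^ S \<le> exp (- (2 * \<mu> * h)) ^ S"
      using h1 exp_ge_add_one_self[of "- (2 * \<mu> * h)"] by (intro power_mono) auto
    also have "\<dots> = exp (- (real S * (2 * \<mu> * h)))"
      by (simp flip: exp_of_nat_mult)
    also have "- (real S * (2 * \<mu> * h)) = c / \<alpha> ^ Suc t - c / \<alpha> ^ t"
    proof -
      have "c / \<alpha> ^ Suc t - c / \<alpha> ^ t = - (c * (\<alpha> - 1)) / (\<alpha> * \<alpha> ^ t)"
        using \<open>\<alpha> > 1\<close> by (simp add: field_simps)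
      also have "c * (\<alpha> - 1) = 2 * \<mu> * real S * \<eta>0 * \<alpha>"
        using \<open>\<alpha> > 1\<close> by (simp add: c_def)
      finally show ?thesis
        using \<open>\<alpha> > 1\<close> by (simp add: h_def)
    qed
    finally show "(1 - 2 * \<mu> * (\<eta>0 / \<alpha> ^ t)) ^ S \<le> exp (c / \<alpha> ^ Suc t - c / \<alpha> ^ t)"
      by (simp only: h_def)
    have "K * (c / \<alpha> ^ Suc t) = h * G\<^sup>2 / (2 * \<mu>)"
      using assms by (simp add: K_def c_def h_def field_simps power2_eq_square)
    then show "err (Suc t * S) - K * (c / \<alpha> ^ Suc t)
        \<le> (1 - 2 * \<mu> * (\<eta>0 / \<alpha> ^ t)) ^ S * (err (t * S) - K * (c / \<alpha> ^ Suc t))"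
      using contraction[where m = "t * S" and s = S and h = h] stage_le[of t] \<open>t < N - 1\<close> \<eta>_stage h1
      by (simp add: h_def err_def Z_def add.commute)
  qed (use assms in \<open>simp_all add: c_def K_def err_def\<close>)
  then have err: "err ((N - 1) * S) \<le> exp (c * \<alpha> / real T - c) * (norm (x1 - xs))\<^sup>2 + K * (1 + c * \<alpha> / real T)"
    unfolding \<alpha>N by (simp add: err_def Z_def prob_space)

  have last: "gp ((N - 1) * S + (S - 1)) \<le> err ((N - 1) * S) / (2 * real S * (\<eta>0 * \<alpha> / real T))
      + \<eta>0 * \<alpha> / real T * G\<^sup>2 / 2 * (1 + harm (S - 1))"
    using last_gap[where m = "(N - 1) * S" and s = S and h = "\<eta>0 * \<alpha> / real T"] stage_le[of "N - 1"] \<eta>_stage assms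
    by (simp add: \<alpha>N[simplified] err_def gp_def Z_def)
  \<comment> \<open>For \<open>S = 1\<close> the harmonic sum is empty, outside the range of the
    logarithmic bound.\<close>
  have "harm (S - 1) \<le> 1 + L"
  proof (cases "S - 1 = 0")
    case False
    then have "harm (S - 1) \<le> 1 + ln (real (S - 1))"
      by (intro harm_le_one_plus_ln) simp
    also have "ln (real (S - 1)) \<le> L"
      unfolding L_def using False \<open>real S \<le> real T\<close> by (subst ln_le_cancel_iff) auto
    finally show ?thesis by simp
  qed (use \<open>L > 0\<close> in \<open>simp add: harm_def\<close>)
  note bound = step_decay_final_bound[OF \<open>\<mu> > 0\<close> \<open>0 < \<eta>0\<close> \<open>\<alpha> > 1\<close> _ \<open>L > 0\<close> \<open>l > 0\<close> _ S refl
      c_def K_def err last this refl refl]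
  \<comment> \<open>The output is the point of the very last query, number \<open>N * S - 1\<close>,
    hence still adapted.\<close>
  have Z_eq: "step_decay_sgd X \<eta>0 \<alpha> S orc x1 N S = Z ((N - 1) * S + (S - 1))"
    using \<open>N \<ge> 1\<close> \<open>S \<ge> 1\<close> by (simp add: step_decay_sgd_eq_sgd_iterate Z_def \<eta>_def)
  have "(N - 1) * S + (S - 1) < N * S"
    using stage_le[of "N - 1"] \<open>N \<ge> 1\<close> \<open>S \<ge> 1\<close> by simp
  from gap_integrable[of "N * S", OF _ this] bound show ?thesis
    unfolding Z_eq Let_def gp_def Z_def L_def l_def using \<open>T > 1\<close> by simp
qed

end
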